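(* Let $G=(\mathcal V,\mathcal E)$ be a finite undirected graph with finite label sets $X_v$ and potentials $\theta_v,\theta_{uv}$. Let $A\subset\mathcal V$ and $x^0\in X_A$ satisfy $$\delta(x^0)\in\operatorname*{arg\,min}_{\mu\in\Lambda_A}\hat E_{A,x^0}(\mu).$$ Then $x^0\in\operatorname{arg\,min}_{x\in X_A}\hat E_{A,x^0}(x)$, and hence $x^0$ is persistent on $A$, i.e. there is a minimizer of $E_{\mathcal V}$ over $X_{\mathcal V}$ which coincides with $x^0$ on $A$.
   Context: For $A\subset\mathcal V$, $X_A=\prod_{v\in A}X_v$, with label sets finite and nonempty, and $\theta_{uv}(x_u,x_v)=\theta_{vu}(x_v,x_u)$. $E_A(x)=\sum_{u\in A}\theta_u(x_u)+\sum_{uv\in\mathcal E:\,u,v\in A}\theta_{uv}(x_u,x_v)$. Boundary nodes: $\partial\mathcal V_A=\{u\in A:\exists v\in\mathcal V\setminus A,\ uv\in\mathcal E\}$; boundary edges: $\partial\mathcal E_A=\{uv\in\mathcal E:u\in A,\ v\in\mathcal V\setminus A\}$. For $uv\in\partial\mathcal E_A$ with $u\in A$ and a test label $y_u$: $\hat\theta_{uv,y_u}(x_u)=\max_{x_v\in X_v}\theta_{uv}(x_u,x_v)$ if $x_u=y_u$, and $\hat\theta_{uv,y_u}(x_u)=\min_{x_v\in X_v}\theta_{uv}(x_u,x_v)$ if $x_u\neq y_u$. $\hat E_{A,y}(x)=E_A(x)+\sum_{uv\in\partial\mathcal E_A:\,u\in\partial\mathcal V_A}\hat\theta_{uv,y_u}(x_u)$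 (only the restriction of $y$ to $\partial\mathcal V_A$ matters). The local polytope $\Lambda_A$ is the set of nonnegative vectors $\mu$ with components $\mu_v(x_v)$ ($v\in A$, $x_v\in X_v$) and $\mu_{uv}(x_u,x_v)$ ($uv\in\mathcal E$, $u,v\in A$) such that $\sum_{x_v\in X_v}\mu_v(x_v)=1$, $\sum_{x_v\in X_v}\mu_{uv}(x_u,x_v)=\mu_u(x_u)$ and $\sum_{x_u\in X_u}\mu_{uv}(x_u,x_v)=\mu_v(x_v)$. For $x\in X_A$, $\delta(x)\in\Lambda_A$ is the indicator vector ($\mu_v(x'_v)=1$ iff $x'_v=x_v$, $\mu_{uv}(x'_u,x'_v)=1$ iff $(x'_u,x'_v)=(x_u,x_v)$, other entries $0$). An energy on $X_A$ that is a sum of unary and pairwise terms is extended linearly to $\Lambda_A$: each unary term $f_v(x_v)$ becomes $\sum_{x_v}f_v(x_v)\mu_v(x_v)$ and each pairwise term $f_{uv}(x_u,x_v)$ becomes $\sum_{x_u,x_v}f_{uv}(x_u,x_v)\mu_{uv}(x_u,x_v)$; this defines $\hat E_{A,y}(\mu)$. *)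

theory Defs
  imports Complex_Main "HOL-Library.FuncSet"
begin

text \<open>An undirected edge is a two-element vertex set. A pairwise quantity \<open>f u v\<close> with
  \<open>f u v = f v u\<close> on an edge \<open>{u, v}\<close> is summed once per edge through its common value on
  the two orientations.\<close>

definition simple_graph :: "'v set \<Rightarrow> 'v set set \<Rightarrow> bool" where
  "simple_graph V E \<longleftrightarrow> finite V \<and> E \<subseteq> {e. e \<subseteq> V \<and> card e = 2}"

definition edge_value :: "('v \<Rightarrow> 'v \<Rightarrow> real) \<Rightarrow> 'v set \<Rightarrow> real" where
  "edge_value f e = (THE t. \<exists>u v. e = {u, v} \<and> t = f u v)"

lemma edge_value_eq:
  assumes "f u v = f v u"
  shows "edge_value f {u, v} = f u v"
  unfolding edge_value_def using assms by (intro the_equality) (auto simp: doubleton_eq_iff)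

definition edges_in :: "'v set set \<Rightarrow> 'v set \<Rightarrow> 'v set set" where
  "edges_in E A = {e \<in> E. e \<subseteq> A}"

definition energy ::
    "'v set set \<Rightarrow> ('v \<Rightarrow> 'l \<Rightarrow> real) \<Rightarrow> ('v \<Rightarrow> 'v \<Rightarrow> 'l \<Rightarrow> 'l \<Rightarrow> real) \<Rightarrow>
     'v set \<Rightarrow> ('v \<Rightarrow> 'l) \<Rightarrow> real" where
  "energy E \<theta> \<theta>p A x =
     (\<Sum>u\<in>A. \<theta> u (x u)) +
     (\<Sum>e\<in>edges_in E A. edge_value (\<lambda>u v. \<theta>p u v (x u) (x v)) e)"

definition boundary_nodes :: "'v set \<Rightarrow> 'v set set \<Rightarrow> 'v set \<Rightarrow> 'v set" where
  "boundary_nodes V E A = {u \<in> A. \<exists>v \<in> V - A. {u, v} \<in> E}"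

text \<open>A boundary edge has exactly one endpoint in \<open>A\<close>, so it is represented by the ordered
  pair (inner endpoint, outer endpoint).\<close>

definition boundary_edges :: "'v set \<Rightarrow> 'v set set \<Rightarrow> 'v set \<Rightarrow> ('v \<times> 'v) set" where
  "boundary_edges V E A = {(u, v). {u, v} \<in> E \<and> u \<in> A \<and> v \<in> V - A}"

definition boundary_potential ::
    "('v \<Rightarrow> 'l set) \<Rightarrow> ('v \<Rightarrow> 'v \<Rightarrow> 'l \<Rightarrow> 'l \<Rightarrow> real) \<Rightarrow> 'v \<Rightarrow> 'v \<Rightarrow> 'l \<Rightarrow> 'l \<Rightarrow> real" where
  "boundary_potential X \<theta>p u v yu xu =
     (if xu = yu then Max ((\<lambda>xv. \<theta>p u v xu xv) ` X v)
      else Min ((\<lambda>xv. \<theta>p u v xu xv) ` X v))"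

definition boundary_energy ::
    "'v set \<Rightarrow> 'v set set \<Rightarrow> ('v \<Rightarrow> 'l set) \<Rightarrow>
     ('v \<Rightarrow> 'l \<Rightarrow> real) \<Rightarrow> ('v \<Rightarrow> 'v \<Rightarrow> 'l \<Rightarrow> 'l \<Rightarrow> real) \<Rightarrow>
     'v set \<Rightarrow> ('v \<Rightarrow> 'l) \<Rightarrow> ('v \<Rightarrow> 'l) \<Rightarrow> real" where
  "boundary_energy V E X \<theta> \<theta>p A y x =
     energy E \<theta> \<theta>p A x +
     (\<Sum>(u, v) \<in> {(u, v) \<in> boundary_edges V E A. u \<in> boundary_nodes V E A}.
        boundary_potential X \<theta>p u v (y u) (x u))"

text \<open>A vector of node and edge components. Each undirected edge carries a single block of
  components, so the two orientations of an edge are tied together by symmetry; entries outside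
  the index set of \<open>\<Lambda>\<^sub>A\<close> are fixed to zero.\<close>

type_synonym ('v, 'l) marginals = "('v \<Rightarrow> 'l \<Rightarrow> real) \<times> ('v \<Rightarrow> 'v \<Rightarrow> 'l \<Rightarrow> 'l \<Rightarrow> real)"

definition marginal_vectors ::
    "'v set set \<Rightarrow> ('v \<Rightarrow> 'l set) \<Rightarrow> 'v set \<Rightarrow> ('v, 'l) marginals set" where
  "marginal_vectors E X A = {(m, p).
     (\<forall>v a. \<not> (v \<in> A \<and> a \<in> X v) \<longrightarrow> m v a = 0) \<and>
     (\<forall>u v a b. \<not> ({u, v} \<in> edges_in E A \<and> a \<in> X u \<and> b \<in> X v) \<longrightarrow> p u v a b = 0) \<and>
     (\<forall>u v a b. p u v a b = p v u b a)}"

definition local_polytope ::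
    "'v set set \<Rightarrow> ('v \<Rightarrow> 'l set) \<Rightarrow> 'v set \<Rightarrow> ('v, 'l) marginals set" where
  "local_polytope E X A = {(m, p) \<in> marginal_vectors E X A.
     (\<forall>v a. m v a \<ge> 0) \<and>
     (\<forall>u v a b. p u v a b \<ge> 0) \<and>
     (\<forall>v\<in>A. (\<Sum>a\<in>X v. m v a) = 1) \<and>
     (\<forall>u v. {u, v} \<in> edges_in E A \<longrightarrow>
        (\<forall>a\<in>X u. (\<Sum>b\<in>X v. p u v a b) = m u a) \<and>
        (\<forall>b\<in>X v. (\<Sum>a\<in>X u. p u v a b) = m v b))}"

definition indicator_vector ::
    "'v set set \<Rightarrow> 'v set \<Rightarrow> ('v \<Rightarrow> 'l) \<Rightarrow> ('v, 'l) marginals" where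
  "indicator_vector E A x =
     (\<lambda>v a. if v \<in> A \<and> a = x v then 1 else 0,
      \<lambda>u v a b. if {u, v} \<in> edges_in E A \<and> (a, b) = (x u, x v) then 1 else 0)"

definition energy_ext ::
    "'v set set \<Rightarrow> ('v \<Rightarrow> 'l set) \<Rightarrow>
     ('v \<Rightarrow> 'l \<Rightarrow> real) \<Rightarrow> ('v \<Rightarrow> 'v \<Rightarrow> 'l \<Rightarrow> 'l \<Rightarrow> real) \<Rightarrow>
     'v set \<Rightarrow> ('v, 'l) marginals \<Rightarrow> real" where
  "energy_ext E X \<theta> \<theta>p A \<mu> =
     (\<Sum>u\<in>A. \<Sum>a\<in>X u. \<theta> u a * fst \<mu> u a) +
     (\<Sum>e\<in>edges_in E A.
        edge_value (\<lambda>u v. \<Sum>a\<in>X u. \<Sum>b\<in>X v. \<theta>p u v a b * snd \<mu> u v a b) e)"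

definition boundary_energy_ext ::
    "'v set \<Rightarrow> 'v set set \<Rightarrow> ('v \<Rightarrow> 'l set) \<Rightarrow>
     ('v \<Rightarrow> 'l \<Rightarrow> real) \<Rightarrow> ('v \<Rightarrow> 'v \<Rightarrow> 'l \<Rightarrow> 'l \<Rightarrow> real) \<Rightarrow>
     'v set \<Rightarrow> ('v \<Rightarrow> 'l) \<Rightarrow> ('v, 'l) marginals \<Rightarrow> real" where
  "boundary_energy_ext V E X \<theta> \<theta>p A y \<mu> =
     energy_ext E X \<theta> \<theta>p A \<mu> +
     (\<Sum>(u, v) \<in> {(u, v) \<in> boundary_edges V E A. u \<in> boundary_nodes V E A}.
        \<Sum>a\<in>X u. boundary_potential X \<theta>p u v (y u) a * fst \<mu> u a)"

definition persistent ::
    "'v set \<Rightarrow> 'v set set \<Rightarrow> ('v \<Rightarrow> 'l set) \<Rightarrow>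
     ('v \<Rightarrow> 'l \<Rightarrow> real) \<Rightarrow> ('v \<Rightarrow> 'v \<Rightarrow> 'l \<Rightarrow> 'l \<Rightarrow> real) \<Rightarrow>
     'v set \<Rightarrow> ('v \<Rightarrow> 'l) \<Rightarrow> bool" where
  "persistent V E X \<theta> \<theta>p A x0 \<longleftrightarrow>
     (\<exists>x. is_arg_min (energy E \<theta> \<theta>p V) (\<lambda>x. x \<in> Pi\<^sub>E V X) x \<and> (\<forall>v\<in>A. x v = x0 v))"

end

theory Submission
  imports Defs
begin

text \<open>The embedding \<open>\<delta>\<close> preserves energies, so minimality over \<open>\<Lambda>\<^sub>A\<close> gives minimality over labelings.
  Now take any minimizer \<open>x\<close> of \<open>E\<^sub>V\<close> and overwrite it with \<open>x\<^sup>0\<close> on \<open>A\<close>. On a boundary edge \<open>uv\<close>, the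
  pairwise term increases by at most the increase of \<open>\<theta>\<close>-hat from \<open>x\<^sub>u\<close> to \<open>x\<^sup>0\<^sub>u\<close>: both are zero if
  \<open>x\<^sub>u = x\<^sup>0\<^sub>u\<close>, and otherwise the latter is a maximum minus a minimum over the labels of \<open>v\<close>.
  Hence \<open>E\<^sub>V\<close> changes by at most the boundary energy of \<open>x\<^sup>0\<close> minus that of \<open>x\<close>, which is
  nonpositive.\<close>

text \<open>The two definite descriptions have equivalent defining predicates, so they agree even
  where uniqueness fails. Rewriting under \<open>edge_value\<close> therefore needs no symmetry of
  \<open>f\<close>.\<close>

lemma edge_value_cong:
  assumes "\<And>u v. e = {u, v} \<Longrightarrow> f u v = g u v"
  shows "edge_value f e = edge_value g e"
proof -
  have "(\<exists>u v. e = {u, v} \<and> t = f u v) \<longleftrightarrow> (\<exists>u v. e = {u, v} \<and> t = g u v)" for t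
    using assms by metis
  then show ?thesis
    unfolding edge_value_def by simp
qed

lemma energy_cong:
  assumes "\<And>v. v \<in> A \<Longrightarrow> x v = y v"
  shows "energy E \<theta> \<theta>p A x = energy E \<theta> \<theta>p A y"
  unfolding energy_def edges_in_def
  by (intro arg_cong2[where f = "(+)"] sum.cong edge_value_cong) (auto simp: assms)

lemma boundary_edges_inner_boundary:
  assumes "A \<subseteq> V"
  shows "{(u, v) \<in> boundary_edges V E A. u \<in> boundary_nodes V E A} = boundary_edges V E A"
  unfolding boundary_edges_def boundary_nodes_def by auto

lemma indicator_vector_in_local_polytope:
  assumes "x \<in> Pi\<^sub>E A X" and "\<And>v. v \<in> A \<Longrightarrow> finite (X v)"
  shows "indicator_vector E A x \<in> local_polytope E X A"
proof -
  have inA: "u \<in> A" "v \<in> A" if "{u, v} \<in> edges_in E A" for u v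
    using that by (auto simp: edges_in_def)
  have xX: "x v \<in> X v" if "v \<in> A" for v
    using assms(1) that by auto
  \<comment> \<open>The two orders of the conjuncts serve the row and the column marginals: in the
    second, the label being summed comes first.\<close>
  have eqs: "(\<Sum>b\<in>X v. if a = x u \<and> b = x v then 1 else 0) = (if a = x u then 1 else (0::real))"
    "(\<Sum>b\<in>X v. if b = x v \<and> a = x u then 1 else 0) = (if a = x u then 1 else (0::real))"
    if "v \<in> A" for u v a
    using assms(2)[OF that] xX[OF that] by (cases "a = x u"; simp)+
  have "(\<lambda>v a. if v \<in> A \<and> a = x v then 1 else 0,
      \<lambda>u v a b. if {u, v} \<in> edges_in E A \<and> (a, b) = (x u, x v) then 1 else (0::real))
      \<in> marginal_vectors E X A"
    unfolding marginal_vectors_def by (auto simp: insert_commute dest: inA xX)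
  then show ?thesis
    unfolding indicator_vector_def local_polytope_def
    using assms(2) xX by (auto simp: inA eqs)
qed

lemma sum_mult_delta:
  fixes f :: "'l \<Rightarrow> real"
  assumes "finite S" "c \<in> S"
  shows "(\<Sum>a\<in>S. f a * (if a = c then 1 else 0)) = f c"
  using assms by (simp add: if_distrib[of "(*) _"] cong: if_cong)

text \<open>Each weighted sum collapses to the one term that \<open>x\<close> selects; since
  \<open>x v\<close> lies in \<open>X v\<close>, that term does occur in the sum.\<close>

lemma energy_ext_indicator_vector:
  assumes "x \<in> Pi\<^sub>E A X" and "\<And>v. v \<in> A \<Longrightarrow> finite (X v)"
  shows "energy_ext E X \<theta> \<theta>p A (indicator_vector E A x) = energy E \<theta> \<theta>p A x"
proof -
  have xX: "x v \<in> X v" if "v \<in> A" for v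
    using assms(1) that by auto
  have pair: "(\<Sum>a\<in>X u. \<Sum>b\<in>X v. \<theta>p u v a b *
      (if {u, v} \<in> edges_in E A \<and> (a, b) = (x u, x v) then 1 else 0)) = \<theta>p u v (x u) (x v)"
    (is "?lhs = _") if e: "{u, v} \<in> edges_in E A" for u v
  proof -
    have uv: "u \<in> A" "v \<in> A"
      using e by (auto simp: edges_in_def)
    \<comment> \<open>The joint indicator factors into one indicator per endpoint, so
      \<open>sum_mult_delta\<close> applies first to the inner and then to the outer sum.\<close>
    have "?lhs = (\<Sum>a\<in>X u. (\<Sum>b\<in>X v. \<theta>p u v a b * (if b = x v then 1 else 0)) *
        (if a = x u then 1 else 0))"
      unfolding sum_distrib_right by (intro sum.cong) (auto simp: e)
    then show ?thesis
      by (simp only: sum_mult_delta assms(2) uv xX)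
  qed
  show ?thesis
    unfolding energy_ext_def energy_def indicator_vector_def fst_conv snd_conv
  proof (intro arg_cong2[where f = "(+)"] sum.cong refl edge_value_cong)
    fix u assume "u \<in> A"
    then show "(\<Sum>a\<in>X u. \<theta> u a * (if u \<in> A \<and> a = x u then 1 else 0)) = \<theta> u (x u)"
      by (simp add: sum_mult_delta[OF assms(2) xX])
  qed (use pair in blast)
qed

text \<open>The test labeling \<open>y\<close> stays independent of \<open>x\<close>: in the
  application it is fixed to \<open>x0\<close> while \<open>x\<close> ranges over all labelings of
  \<open>A\<close>.\<close>

lemma boundary_energy_ext_indicator_vector:
  assumes "x \<in> Pi\<^sub>E A X" and "\<And>v. v \<in> A \<Longrightarrow> finite (X v)"
  shows "boundary_energy_ext V E X \<theta> \<theta>p A y (indicator_vector E A x) =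
    boundary_energy V E X \<theta> \<theta>p A y x"
proof -
  have "(\<Sum>a\<in>X u. boundary_potential X \<theta>p u v (y u) a * fst (indicator_vector E A x) u a) =
      boundary_potential X \<theta>p u v (y u) (x u)" if "u \<in> A" for u v
    using that assms by (simp add: indicator_vector_def sum_mult_delta PiE_mem)
  then show ?thesis
    unfolding boundary_energy_ext_def boundary_energy_def
    by (auto simp: energy_ext_indicator_vector[OF assms] boundary_nodes_def intro!: sum.cong)
qed

text \<open>Every edge lies inside \<open>A\<close>, lies inside \<open>V - A\<close>, or crosses
  between them. Symmetry lets the value of a crossing edge be read from its inner to its outer
  endpoint.\<close>

lemma energy_split:
  assumes "simple_graph V E" and "A \<subseteq> V"
    and sym: "\<And>u v. {u, v} \<in> E \<Longrightarrow> \<theta>p u v (x u) (x v) = \<theta>p v u (x v) (x u)"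
  shows "energy E \<theta> \<theta>p V x = energy E \<theta> \<theta>p A x + energy E \<theta> \<theta>p (V - A) x +
    (\<Sum>(u, v)\<in>boundary_edges V E A. \<theta>p u v (x u) (x v))"
proof -
  let ?g = "edge_value (\<lambda>u v. \<theta>p u v (x u) (x v))"
  let ?cut = "(\<lambda>(u, v). {u, v}) ` boundary_edges V E A"
  have finV: "finite V" and E: "E \<subseteq> {e. e \<subseteq> V \<and> card e = 2}"
    using assms(1) by (auto simp: simple_graph_def)
  have finE: "finite E"
    by (rule finite_subset[of _ "Pow V"]) (use E finV in auto)
  have "e \<in> edges_in E A \<union> edges_in E (V - A) \<union> ?cut" if "e \<in> E" for e
  proof -
    obtain u v where uv: "e = {u, v}" "u \<noteq> v"
      using \<open>e \<in> E\<close> E card_2_iff[of e] by blast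
    with \<open>e \<in> E\<close> E have V: "u \<in> V" "v \<in> V"
      by auto
    have "(u, v) \<in> boundary_edges V E A" if "u \<in> A" "v \<notin> A"
      using that \<open>e \<in> E\<close> uv V by (auto simp: boundary_edges_def)
    moreover have "(v, u) \<in> boundary_edges V E A" if "v \<in> A" "u \<notin> A"
      using that \<open>e \<in> E\<close> uv V by (auto simp: boundary_edges_def insert_commute)
    ultimately show ?thesis
      using uv V that by (force simp: edges_in_def insert_commute)
  qed
  then have edges: "edges_in E V = edges_in E A \<union> edges_in E (V - A) \<union> ?cut"
    using \<open>A \<subseteq> V\<close> E by (auto simp: edges_in_def boundary_edges_def)
  have fin: "finite (edges_in E B)" for B
    using finE by (simp add: edges_in_def)
  have fincut: "finite ?cut"
    by (rule finite_subset[OF _ finE]) (auto simp: boundary_edges_def)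
  \<comment> \<open>An edge inside both \<open>A\<close> and \<open>V - A\<close> could only be the
    empty set.\<close>
  have ne: "{} \<notin> E"
    using E by auto
  have disj: "edges_in E A \<inter> edges_in E (V - A) = {}"
    "(edges_in E A \<union> edges_in E (V - A)) \<inter> ?cut = {}"
    using ne by (auto simp: edges_in_def boundary_edges_def)
      (metis Diff_disjoint Int_greatest subset_empty)
  \<comment> \<open>Exactly one endpoint is in \<open>A\<close>, which recovers the orientation; no
    crossing edge is counted twice.\<close>
  have "inj_on (\<lambda>(u, v). {u, v}) (boundary_edges V E A)"
    by (auto simp: inj_on_def boundary_edges_def doubleton_eq_iff)
  moreover have "?g {u, v} = \<theta>p u v (x u) (x v)" if "(u, v) \<in> boundary_edges V E A" for u v
    using that sym[of u v] by (intro edge_value_eq) (simp add: boundary_edges_def)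
  ultimately have "sum ?g ?cut = (\<Sum>(u, v)\<in>boundary_edges V E A. \<theta>p u v (x u) (x v))"
    by (auto simp: sum.reindex intro!: sum.cong)
  then have "sum ?g (edges_in E V) = sum ?g (edges_in E A) + sum ?g (edges_in E (V - A)) +
      (\<Sum>(u, v)\<in>boundary_edges V E A. \<theta>p u v (x u) (x v))"
    unfolding edges by (simp add: sum.union_disjoint fin fincut disj)
  moreover have "(\<Sum>u\<in>V. \<theta> u (x u)) = (\<Sum>u\<in>A. \<theta> u (x u)) + (\<Sum>u\<in>V - A. \<theta> u (x u))"
    using sum.subset_diff[OF \<open>A \<subseteq> V\<close> finV] by (simp add: add.commute)
  ultimately show ?thesis
    by (simp add: energy_def)
qed

lemma pairwise_diff_le_boundary_potential_diff:
  assumes "finite (X v)" and "b \<in> X v"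
  shows "\<theta>p u v y b - \<theta>p u v a b \<le>
    boundary_potential X \<theta>p u v y y - boundary_potential X \<theta>p u v y a"
proof (cases "a = y")
  case False
  have "\<theta>p u v y b \<le> Max ((\<lambda>c. \<theta>p u v y c) ` X v)"
    "Min ((\<lambda>c. \<theta>p u v a c) ` X v) \<le> \<theta>p u v a b"
    using assms by auto
  with False show ?thesis
    by (simp add: boundary_potential_def)
qed simp

text \<open>By \<open>energy_split\<close>, the part inside \<open>A\<close> becomes that of
  \<open>y\<close>, the part inside \<open>V - A\<close> cancels, and the crossing edges are
  compared one by one.\<close>

lemma energy_override_le:
  assumes G: "simple_graph V E" and AV: "A \<subseteq> V"
    and fin: "\<And>v. v \<in> V \<Longrightarrow> finite (X v)"
    and sym: "\<And>u v a b. {u, v} \<in> E \<Longrightarrow> a \<in> X u \<Longrightarrow> b \<in> X v \<Longrightarrow> \<theta>p u v a b = \<theta>p v u b a"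
    and y: "y \<in> Pi A X" and x: "x \<in> Pi V X"
  shows "energy E \<theta> \<theta>p V (override_on x y A) - energy E \<theta> \<theta>p V x \<le>
    boundary_energy V E X \<theta> \<theta>p A y y - boundary_energy V E X \<theta> \<theta>p A y x"
proof -
  let ?z = "override_on x y A"
  have inV: "u \<in> V" "v \<in> V" if "{u, v} \<in> E" for u v
    using G that by (auto simp: simple_graph_def)
  have z: "?z \<in> Pi V X"
    using x y by (auto simp: override_on_def Pi_iff)
  have split: "energy E \<theta> \<theta>p V w = energy E \<theta> \<theta>p A w + energy E \<theta> \<theta>p (V - A) w +
      (\<Sum>(u, v)\<in>boundary_edges V E A. \<theta>p u v (w u) (w v))" if "w \<in> Pi V X" for w
    using that inV by (intro energy_split[OF G AV] sym) auto
  have zA: "energy E \<theta> \<theta>p A ?z = energy E \<theta> \<theta>p A y"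
    and zB: "energy E \<theta> \<theta>p (V - A) ?z = energy E \<theta> \<theta>p (V - A) x"
    by (auto intro: energy_cong)
  \<comment> \<open>On such a pair \<open>?z u = y u\<close> and \<open>?z v = x v\<close>: only the
    inner label changes, as the edgewise bound requires.\<close>
  have "(\<Sum>(u, v)\<in>boundary_edges V E A. \<theta>p u v (?z u) (?z v) - \<theta>p u v (x u) (x v)) \<le>
      (\<Sum>(u, v)\<in>boundary_edges V E A. boundary_potential X \<theta>p u v (y u) (y u) -
        boundary_potential X \<theta>p u v (y u) (x u))"
    using x fin by (intro sum_mono)
      (auto simp: boundary_edges_def intro!: pairwise_diff_le_boundary_potential_diff)
  then show ?thesis
    unfolding boundary_energy_def boundary_edges_inner_boundary[OF AV]
      split[OF x] split[OF z] zA zB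
    by (simp add: case_prod_beta sum_subtractf)
qed

theorem corollary1:
  fixes V :: "'v set" and E :: "'v set set" and X :: "'v \<Rightarrow> 'l set"
    and \<theta> :: "'v \<Rightarrow> 'l \<Rightarrow> real" and \<theta>p :: "'v \<Rightarrow> 'v \<Rightarrow> 'l \<Rightarrow> 'l \<Rightarrow> real"
    and A :: "'v set" and x0 :: "'v \<Rightarrow> 'l"
  assumes "simple_graph V E"
    and "\<And>v. v \<in> V \<Longrightarrow> finite (X v) \<and> X v \<noteq> {}"
    and "\<And>u v a b. {u, v} \<in> E \<Longrightarrow> a \<in> X u \<Longrightarrow> b \<in> X v \<Longrightarrow> \<theta>p u v a b = \<theta>p v u b a"
    and "A \<subseteq> V"
    and "x0 \<in> Pi\<^sub>E A X"
    and "is_arg_min (boundary_energy_ext V E X \<theta> \<theta>p A x0)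
           (\<lambda>\<mu>. \<mu> \<in> local_polytope E X A) (indicator_vector E A x0)"
  shows "is_arg_min (boundary_energy V E X \<theta> \<theta>p A x0) (\<lambda>x. x \<in> Pi\<^sub>E A X) x0
         \<and> persistent V E X \<theta> \<theta>p A x0"
proof
  let ?B = "boundary_energy V E X \<theta> \<theta>p A x0" and ?F = "energy E \<theta> \<theta>p V"
  have finA: "finite (X v)" if "v \<in> A" for v
    using assms(2,4) that by auto
  have B_le: "?B x0 \<le> ?B x" if x: "x \<in> Pi\<^sub>E A X" for x
  proof -
    have "boundary_energy_ext V E X \<theta> \<theta>p A x0 (indicator_vector E A x0) \<le>
        boundary_energy_ext V E X \<theta> \<theta>p A x0 (indicator_vector E A x)"
      using assms(6) indicator_vector_in_local_polytope[OF x finA, where E = E]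
      unfolding is_arg_min_linorder by blast
    then show ?thesis
      by (simp add: boundary_energy_ext_indicator_vector x assms(5) finA)
  qed
  then show "is_arg_min ?B (\<lambda>x. x \<in> Pi\<^sub>E A X) x0"
    using assms(5) by (simp add: is_arg_min_linorder)
  have "finite V"
    using assms(1) by (simp add: simple_graph_def)
  then have "finite (Pi\<^sub>E V X)"
    using assms(2) by (intro finite_PiE) auto
  \<comment> \<open>Nonempty label sets make the finite labeling space nonempty, so a global
    minimizer exists.\<close>
  moreover have "Pi\<^sub>E V X \<noteq> {}"
    using assms(2) by (simp add: PiE_eq_empty_iff)
  ultimately obtain x where x: "x \<in> Pi\<^sub>E V X" and min: "\<And>w. w \<in> Pi\<^sub>E V X \<Longrightarrow> ?F x \<le> ?F w"
    using ex_min_if_finite[of "?F ` Pi\<^sub>E V X"] by (force simp: not_less)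
  let ?z = "override_on x x0 A"
  \<comment> \<open>\<open>x\<close> is extensional on \<open>V\<close>, so it must be restricted
    before minimality of \<open>x0\<close> over \<open>Pi\<^sub>E A X\<close> applies. The boundary
    energy reads labels on \<open>A\<close> only, so the restriction does not change it.\<close>
  have "restrict x A \<in> Pi\<^sub>E A X"
    using x assms(4) by auto
  then have "?B x0 \<le> ?B (restrict x A)"
    by (rule B_le)
  also have "\<dots> = ?B x"
    unfolding boundary_energy_def
    by (auto simp: boundary_nodes_def intro!: arg_cong2[where f = "(+)"] energy_cong sum.cong)
  finally have "?F ?z \<le> ?F x"
    using energy_override_le[OF assms(1,4), of X \<theta>p x0 x \<theta>] assms(2,3,5) x
    by (fastforce simp: PiE_def)
  moreover have "?z \<in> Pi\<^sub>E V X"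
    using x assms(4,5) by (auto simp: override_on_def PiE_iff extensional_def)
  ultimately have "is_arg_min ?F (\<lambda>x. x \<in> Pi\<^sub>E V X) ?z"
    using min by (force simp: is_arg_min_linorder intro: order_trans)
  then show "persistent V E X \<theta> \<theta>p A x0"
    unfolding persistent_def by (metis override_on_apply_in)
qed

end
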